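(* Let $\alpha\in(0,1)$, let $N\ge 3$ be an integer, and let $A\subset [N]$ be a Sidon set such that $|A_p|\le \alpha p$ for every prime $p$. Then for every $\delta\in(0,1/4)$, $$|A|\ll_{\alpha,\delta}\sqrt{N}\exp\left(-\left(\frac14-\delta\right)\log\frac1\alpha\cdot\frac{\log N}{\log\log N}\right).$$
   Context: $[N]=\{1,\ldots,N\}$. A set $A$ of integers is a Sidon set if all sums $a+a'$ with $a,a'\in A$ are distinct up to the trivial symmetry $a+a'=a'+a$. For a prime $p$, $A_p=\{a \bmod p: a\in A\}\subseteq\mathbb Z/p\mathbb Z$. The notation $X\ll_{\alpha,\delta}Y$ means $X\le CY$ for a constant $C>0$ depending only on $\alpha,\delta$ (not on $N$ or $A$). *)

theory Defs
  imports Complex_Main "HOL-Computational_Algebra.Primes"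
begin

definition sidon :: "int set \<Rightarrow> bool" where
  "sidon A \<longleftrightarrow>
     (\<forall>a\<in>A. \<forall>b\<in>A. \<forall>c\<in>A. \<forall>d\<in>A.
        a + b = c + d \<longrightarrow> (a = c \<and> b = d) \<or> (a = d \<and> b = c))"

text \<open>
  The residue classes modulo p are represented by their canonical representatives
  in \<open>{0..<p}\<close>.
\<close>

definition residues_mod :: "int set \<Rightarrow> nat \<Rightarrow> int set" where
  "residues_mod A p = (\<lambda>a. a mod int p) ` A"

end

theory Submission
  imports Defs "HOL-Analysis.Convex" "HOL-Real_Asymp.Real_Asymp"
begin

text \<open>
  The proof plays the Sidon property against the sparseness of \<open>A\<close> modulo a composite number.
  Let \<open>q\<close> be a product of \<open>K\<close> distinct primes with \<open>q \<le> \<surd>N\<close>.  By the Chinese remainder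
  theorem the hypothesis on primes multiplies up: \<open>A\<close> meets at most \<open>\<alpha>\<^sup>K q\<close> classes modulo \<open>q\<close>
  (\<open>card_residues_mod_prod_primes_le\<close>), so by Cauchy-Schwarz many pairs of elements of \<open>A\<close>
  are congruent modulo \<open>q\<close>.  But in a Sidon set distinct pairs have distinct differences, and
  there are at most \<open>2N/q\<close> nonzero multiples of \<open>q\<close> between \<open>-N\<close> and \<open>N\<close>.  Comparing the two
  counts gives
  \<open>|A|\<^sup>2 \<le> \<alpha>\<^sup>K q (|A| + 2N/q)\<close>,
  and as \<open>q \<le> \<surd>N\<close> this forces \<open>|A| \<le> 2 \<surd>N \<alpha>\<^bsup>K/2\<^esup>\<close> (\<open>sidon_card_le_of_few_residues\<close>).

  It remains to make \<open>K\<close> large.  Any \<open>K\<close> primes below \<open>y = (log N)\<^sup>c\<close> have product at most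
  \<open>y\<^sup>K\<close>, which is at most \<open>\<surd>N\<close> as soon as
  \<open>K \<le> log N / (2 c log log N)\<close>.  For every fixed \<open>c > 1\<close> there are that many primes below \<open>y\<close>
  once \<open>N\<close> is large, by a Chebyshev lower bound for the number of primes
  (\<open>card_primes_lower_bound\<close>).  Taking \<open>c = 1 / (1 - 4\<delta>)\<close> turns the exponent \<open>K/2\<close> into
  \<open>(1/4 - \<delta>) log N / log log N\<close>, up to a loss of at most \<open>1/2\<close> from rounding \<open>K\<close> down;
  that loss and the finitely many small \<open>N\<close> go into the constant.
\<close>

section \<open>A Sidon set in few residue classes\<close>

text \<open>
  In a Sidon set the difference \<open>a - b \<noteq> 0\<close> determines the pair \<open>(a, b)\<close>, because \<open>a - b = c - d\<close>
  rearranges to \<open>a + d = c + b\<close>.  Hence the quotients \<open>(a - b) / q\<close> are distinct nonzero integers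
  of absolute value at most \<open>N / q\<close>.
\<close>
lemma card_congruent_pairs_sidon:
  fixes A :: "int set" and N q :: nat
  assumes "sidon A" "A \<subseteq> {1..int N}" "q > 0"
  shows "card {(a, b). a \<in> A \<and> b \<in> A \<and> a \<noteq> b \<and> a mod int q = b mod int q} \<le> 2 * (N div q)"
    (is "card ?S \<le> _")
proof -
  let ?f = "\<lambda>(a :: int, b :: int). (a - b) div int q"
  let ?k = "int (N div q)"
  have diff: "int q * ((a - b) div int q) = a - b" if "(a, b) \<in> ?S" for a b
    using that by (auto simp: mod_eq_dvd_iff)
  have inj: "inj_on ?f ?S"
  proof (rule inj_onI)
    fix z w assume zw: "z \<in> ?S" "w \<in> ?S" "?f z = ?f w"
    obtain a b c d where eq: "z = (a, b)" "w = (c, d)" by (metis surj_pair)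
    have mem: "a \<in> A" "b \<in> A" "c \<in> A" "d \<in> A" "a \<noteq> b" using zw(1,2) eq by auto
    have "int q * ((a - b) div int q) = a - b" "int q * ((c - d) div int q) = c - d"
      using diff zw(1,2) eq by blast+
    moreover have "(a - b) div int q = (c - d) div int q" using zw(3) eq by simp
    ultimately have "a - b = c - d" by metis
    hence "a + d = c + b" by simp
    hence "a = c \<and> d = b \<or> a = b \<and> d = c"
      using \<open>sidon A\<close> mem unfolding sidon_def by blast
    thus "z = w" using mem eq by auto
  qed
  have img: "?f ` ?S \<subseteq> {-?k..?k} - {0}"
  proof (rule image_subsetI)
    fix z assume z: "z \<in> ?S"
    obtain a b where ab: "z = (a, b)" by force
    define t where "t = (a - b) div int q"
    have t: "int q * t = a - b" using diff z ab t_def by blast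
    have "a \<in> {1..int N}" "b \<in> {1..int N}" "a \<noteq> b" using z ab assms by auto
    hence "\<bar>int q * t\<bar> \<le> int N" "t \<noteq> 0" using t by auto
    hence "int q * \<bar>t\<bar> \<le> int N" "t \<noteq> 0" by (simp_all add: abs_mult)
    moreover from this have "\<bar>t\<bar> \<le> ?k"
      using \<open>q > 0\<close> zdiv_mono1[of "int q * \<bar>t\<bar>" "int N" "int q"] by (simp add: zdiv_int)
    ultimately show "?f z \<in> {-?k..?k} - {0}" using ab t_def by auto
  qed
  have "card ?S = card (?f ` ?S)" using inj by (simp add: card_image)
  also have "\<dots> \<le> card ({-?k..?k} - {0})" using img by (intro card_mono) auto
  also have "\<dots> = 2 * (N div q)" by simp
  finally show ?thesis .
qed

text \<open>
  Cauchy-Schwarz over the residue classes bounds \<open>|A|\<^sup>2\<close> by the number of occupied classes times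
  the number of congruent pairs; the latter are the \<open>|A|\<close> diagonal pairs together with those
  counted in \<open>card_congruent_pairs_sidon\<close>.
\<close>
lemma sidon_card_sq_le:
  fixes A :: "int set" and N q :: nat
  assumes "sidon A" "A \<subseteq> {1..int N}" "q > 0"
  shows "(real (card A))\<^sup>2 \<le> real (card (residues_mod A q)) * (real (card A) + 2 * (real N / real q))"
proof -
  let ?R = "residues_mod A q"
  define F where "F r = {a \<in> A. a mod int q = r}" for r
  have finA: "finite A" using assms finite_subset by blast
  have finR: "finite ?R" using finA by (simp add: residues_mod_def)
  have finF: "finite (F r)" for r using finA by (simp add: F_def)
  let ?S = "{(a, b). a \<in> A \<and> b \<in> A \<and> a \<noteq> b \<and> a mod int q = b mod int q}"
  have finS: "finite ?S" by (rule finite_subset[of _ "A \<times> A"]) (use finA in auto)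
  have "A = (\<Union>r\<in>?R. F r)" by (auto simp: F_def residues_mod_def)
  hence "card A = card (\<Union>r\<in>?R. F r)" by simp
  also have "\<dots> = (\<Sum>r\<in>?R. card (F r))"
    using finR finF by (intro card_UN_disjoint) (auto simp: F_def)
  finally have cardA: "card A = (\<Sum>r\<in>?R. card (F r))" .
  have "(\<Sum>r\<in>?R. (card (F r))\<^sup>2) = (\<Sum>r\<in>?R. card (F r \<times> F r))"
    by (simp add: card_cartesian_product power2_eq_square)
  also have "\<dots> = card (\<Union>r\<in>?R. F r \<times> F r)"
    using finR finF by (intro card_UN_disjoint[symmetric]) (auto simp: F_def)
  also have "(\<Union>r\<in>?R. F r \<times> F r) = (\<lambda>a. (a, a)) ` A \<union> ?S"
    by (auto simp: F_def residues_mod_def)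
  also have "card \<dots> \<le> card ((\<lambda>a. (a, a)) ` A) + card ?S" by (rule card_Un_le)
  also have "\<dots> \<le> card A + 2 * (N div q)"
    using card_congruent_pairs_sidon[OF assms] card_image_le[OF finA] by (intro add_mono)
  finally have "real (\<Sum>r\<in>?R. (card (F r))\<^sup>2) \<le> real (card A + 2 * (N div q))"
    by (rule of_nat_mono)
  hence sq: "(\<Sum>r\<in>?R. (real (card (F r)))\<^sup>2) \<le> real (card A) + 2 * (real N / real q)"
    using of_nat_div_le_of_nat[of N q, where ?'a = real] by simp
  have "(real (card A))\<^sup>2 = (\<Sum>r\<in>?R. real (card (F r)))\<^sup>2" by (simp add: cardA)
  also have "\<dots> \<le> (\<Sum>r\<in>?R. (real (card (F r)))\<^sup>2) * card ?R"
    by (rule sum_squared_le_sum_of_squares)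
  also have "\<dots> \<le> (real (card A) + 2 * (real N / real q)) * card ?R"
    by (intro mult_right_mono sq) simp
  finally show ?thesis by (simp add: mult.commute)
qed

lemma finite_residues_mod: "m > 0 \<Longrightarrow> finite (residues_mod A m)"
  by (rule finite_subset[of _ "{0..<int m}"]) (auto simp: residues_mod_def)

text \<open>
  By the uniqueness half of the Chinese remainder theorem, a class modulo \<open>m n\<close> is determined by
  its reductions modulo \<open>m\<close> and \<open>n\<close>.
\<close>
lemma card_residues_mod_mult_le:
  assumes "coprime m n" "m > 0" "n > 0"
  shows "card (residues_mod A (m * n)) \<le> card (residues_mod A m) * card (residues_mod A n)"
proof -
  let ?f = "\<lambda>r. (r mod int m, r mod int n)"
  have inj: "inj_on ?f (residues_mod A (m * n))"
  proof (rule inj_onI)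
    fix r s assume rs: "r \<in> residues_mod A (m * n)" "s \<in> residues_mod A (m * n)" "?f r = ?f s"
    hence "int m dvd r - s" "int n dvd r - s" by (auto simp: mod_eq_dvd_iff)
    hence "int m * int n dvd r - s" using assms by (intro divides_mult) auto
    hence "r mod int (m * n) = s mod int (m * n)" by (simp add: mod_eq_dvd_iff)
    thus "r = s" using rs by (auto simp: residues_mod_def)
  qed
  have img: "?f ` residues_mod A (m * n) \<subseteq> residues_mod A m \<times> residues_mod A n"
    by (auto simp: residues_mod_def mod_mod_cancel)
  have "card (residues_mod A (m * n)) \<le> card (residues_mod A m \<times> residues_mod A n)"
    using assms by (intro card_inj_on_le[OF inj img] finite_cartesian_product finite_residues_mod)
  thus ?thesis by (simp add: card_cartesian_product)
qed

lemma card_residues_mod_prod_primes_le: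
  fixes \<alpha> :: real
  assumes "finite P" "\<And>p. p \<in> P \<Longrightarrow> prime p" "\<alpha> \<ge> 0"
    "\<And>p. p \<in> P \<Longrightarrow> real (card (residues_mod A p)) \<le> \<alpha> * real p"
  shows "real (card (residues_mod A (\<Prod>P))) \<le> \<alpha> ^ card P * real (\<Prod>P)"
  using assms(1,2,4)
proof (induction P rule: finite_induct)
  case empty
  have "residues_mod A 1 \<subseteq> {0}" by (auto simp: residues_mod_def)
  hence "card (residues_mod A 1) \<le> card {0 :: int}" by (intro card_mono) auto
  thus ?case by simp
next
  case (insert p P)
  have "coprime p (\<Prod>P)"
    using insert by (intro prod_coprime_right) (auto intro!: primes_coprime)
  moreover have "p > 0" "\<Prod>P > 0"
    using insert.prems(1) by (auto intro!: prod_pos simp: prime_gt_0_nat)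
  ultimately have "card (residues_mod A (\<Prod>(insert p P)))
      \<le> card (residues_mod A p) * card (residues_mod A (\<Prod>P))"
    using insert card_residues_mod_mult_le by simp
  hence "real (card (residues_mod A (\<Prod>(insert p P))))
      \<le> real (card (residues_mod A p)) * real (card (residues_mod A (\<Prod>P)))"
    by (metis of_nat_le_iff of_nat_mult)
  also have "\<dots> \<le> (\<alpha> * real p) * (\<alpha> ^ card P * real (\<Prod>P))"
    using insert \<open>\<alpha> \<ge> 0\<close> by (intro mult_mono) auto
  finally show ?case using insert by (simp add: mult_ac)
qed

text \<open>
  Write \<open>x = |A|\<close>, \<open>s = \<surd>N\<close> and \<open>t\<^sup>2 = \<alpha>\<^sup>K\<close>.  The preceding two estimates combine to
  \<open>x\<^sup>2 \<le> t\<^sup>2 q x + 2 s\<^sup>2 t\<^sup>2\<close>.  Since \<open>q \<le> s\<close> and \<open>t \<le> 1\<close>, one factor \<open>t\<close> can be given away in the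
  linear term, leaving the quadratic inequality \<open>(x - 2 s t) (x + s t) \<le> 0\<close>.
\<close>
lemma sidon_card_le_of_few_residues:
  fixes \<alpha> :: real and N :: nat
  assumes sid: "sidon A" and A: "A \<subseteq> {1..int N}" and \<alpha>: "0 \<le> \<alpha>" "\<alpha> \<le> 1"
    and P: "finite P" "\<And>p. p \<in> P \<Longrightarrow> prime p"
    and res: "\<And>p. p \<in> P \<Longrightarrow> real (card (residues_mod A p)) \<le> \<alpha> * real p"
    and small: "real (\<Prod>P) \<le> sqrt (real N)"
  shows "real (card A) \<le> 2 * sqrt (real N) * sqrt (\<alpha> ^ card P)"
proof -
  define x s t where "x = real (card A)" and "s = sqrt (real N)" and "t = sqrt (\<alpha> ^ card P)"
  let ?q = "\<Prod>P"
  have q: "?q > 0" using P by (auto intro!: prod_pos simp: prime_gt_0_nat)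
  have t: "0 \<le> t" "t \<le> 1" "\<alpha> ^ card P = t\<^sup>2" using \<alpha> by (auto simp: t_def power_le_one)
  have s: "0 \<le> s" "real N = s\<^sup>2" "real ?q \<le> s" using small by (auto simp: s_def)
  have x: "0 \<le> x" by (simp add: x_def)
  have "x\<^sup>2 \<le> real (card (residues_mod A ?q)) * (x + 2 * (s\<^sup>2 / ?q))"
    using sidon_card_sq_le[OF sid A q] s by (simp add: x_def)
  also have "\<dots> \<le> (t\<^sup>2 * ?q) * (x + 2 * (s\<^sup>2 / ?q))"
    using card_residues_mod_prod_primes_le[OF P \<alpha>(1) res] t x
    by (intro mult_right_mono add_nonneg_nonneg) (auto simp del: of_nat_prod)
  also have "\<dots> = t * (t * real ?q) * x + 2 * (s * t)\<^sup>2"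
    using q by (simp add: field_simps power2_eq_square del: of_nat_prod)
  also have "t * (t * real ?q) * x \<le> t * (1 * s) * x"
    using t s x by (intro mult_right_mono mult_left_mono mult_mono) (auto simp del: of_nat_prod)
  finally have "x\<^sup>2 \<le> s * t * x + 2 * (s * t)\<^sup>2" by (simp add: mult_ac)
  hence "(x - 2 * (s * t)) * (x + s * t) \<le> 0" by (simp add: algebra_simps power2_eq_square)
  moreover have "s * t \<ge> 0" using s(1) t(1) by simp
  ultimately have "x \<le> 2 * (s * t)"
    using x by (smt (verit) mult_pos_pos)
  thus ?thesis by (simp add: x_def s_def t_def)
qed

section \<open>Many small primes\<close>

text \<open>
  The numbers \<open>b(n, m) = m (n choose m)\<close> satisfy the recurrence of the Leibniz harmonic triangle,
  \<open>1 / b(n, m) = 1 / b(n - 1, m) - 1 / b(n, m + 1)\<close>,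
  and \<open>b(m, m) = m\<close>.  So \<open>D / b(n, m)\<close> is an integer by induction on \<open>n - m\<close>, both terms on the
  right having a smaller difference.
\<close>
lemma times_binomial_dvd_common_multiple:
  fixes D m n :: nat
  assumes "\<And>i. 1 \<le> i \<Longrightarrow> i \<le> n \<Longrightarrow> i dvd D" "1 \<le> m" "m \<le> n"
  shows "m * (n choose m) dvd D"
proof -
  have "m * ((m + k) choose m) dvd D" if "1 \<le> m" "m + k \<le> n" for m k
    using that
  proof (induction k arbitrary: m)
    case 0
    thus ?case using assms(1) by simp
  next
    case (Suc k)
    define x where "x = int (m * ((m + k) choose m))"
    define y where "y = int (Suc m * ((m + Suc k) choose Suc m))"
    define z where "z = int (m * ((m + Suc k) choose m))"
    have "x dvd int D" "y dvd int D"
      using Suc.IH[of m] Suc.IH[of "Suc m"] Suc.prems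
      by (simp_all only: x_def y_def int_dvd_int_iff) simp_all
    then obtain a b where ab: "int D = x * a" "int D = y * b" by (elim dvdE)
    have pos: "x > 0" "y > 0" using Suc.prems unfolding x_def y_def of_nat_0_less_iff
      by (simp_all only: nat_0_less_mult_iff zero_less_binomial_iff) auto
    \<comment> \<open>With \<open>n = m + k + 1\<close>, the next two facts say \<open>n x = (n - m) z = m y\<close>.  They yield
      \<open>z (y - x) = x y\<close>, the recurrence \<open>1/z = 1/x - 1/y\<close> cleared of denominators.\<close>
    have nx: "int (m + Suc k) * x = int (Suc k) * z"
      using binomial_absorb_comp[of "m + Suc k" m]
      unfolding x_def z_def of_nat_mult[symmetric] of_nat_eq_iff
      by (simp add: mult_ac)
    have "(m + Suc k choose Suc m) * Suc m = (m + Suc k choose m) * Suc k"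
      using binomial_absorption[of m "m + Suc k"] binomial_absorb_comp[of "m + Suc k" m]
      by (simp add: mult_ac)
    hence my: "int m * y = int (Suc k) * z"
      unfolding y_def z_def of_nat_mult[symmetric] of_nat_eq_iff
      by (simp add: mult_ac)
    have "int (Suc k) * (z * (y - x)) = int (Suc k) * z * y - int (Suc k) * z * x"
      by (simp add: algebra_simps)
    also have "\<dots> = int (m + Suc k) * x * y - int m * y * x" by (simp only: nx my)
    also have "\<dots> = int (Suc k) * (x * y)" by (simp add: algebra_simps)
    finally have zyx: "z * (y - x) = x * y" by simp
    have "(z * (a - b)) * (x * y) = z * ((x * a) * y - (y * b) * x)" by (simp add: algebra_simps)
    also have "\<dots> = int D * (z * (y - x))" unfolding ab[symmetric] by (simp add: algebra_simps)
    also have "\<dots> = int D * (x * y)" by (simp add: zyx)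
    finally have "z * (a - b) = int D" using pos by simp
    hence "z dvd int D" by (metis dvd_triv_left)
    thus ?case by (simp only: z_def int_dvd_int_iff)
  qed
  from this[of m "n - m"] assms show ?thesis by simp
qed

text \<open>
  The multiple is the least common multiple of \<open>1, \<dots>, n\<close>, written as the product over the
  primes \<open>p \<le> n\<close> of the largest power of \<open>p\<close> not exceeding \<open>n\<close>: each factor is at most \<open>n\<close>.
\<close>
lemma common_multiple_le_power_card_primes:
  fixes n :: nat
  obtains D where "D > 0" "\<And>i. 1 \<le> i \<Longrightarrow> i \<le> n \<Longrightarrow> i dvd D" "D \<le> n ^ card {p. prime p \<and> p \<le> n}"
proof (cases "n = 0")
  case True
  hence none: "{p. prime p \<and> p \<le> n} = {}" by auto
  show ?thesis
  proof (rule that)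
    show "1 \<le> n ^ card {p. prime p \<and> p \<le> n}" unfolding none by simp
  qed (use True in auto)
next
  case False
  let ?P = "{p. prime p \<and> p \<le> n}"
  have fin: "finite ?P" by simp
  have "\<exists>e. p ^ e \<le> n \<and> n < p ^ (e + 1)" if "p \<in> ?P" for p
    using that False ex_power_ivl1[of p n] prime_ge_2_nat by auto
  then obtain e where e: "\<And>p. p \<in> ?P \<Longrightarrow> p ^ e p \<le> n \<and> n < p ^ (e p + 1)" by metis
  define D where "D = (\<Prod>p\<in>?P. p ^ e p)"
  show ?thesis
  proof (rule that)
    show "D > 0" unfolding D_def by (intro prod_pos) (auto simp: prime_gt_0_nat)
    have "D \<le> (\<Prod>p\<in>?P. n)" unfolding D_def using e by (intro prod_mono) auto
    thus "D \<le> n ^ card ?P" by simp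
    fix i assume i: "1 \<le> i" "i \<le> n"
    have sub: "prime_factors i \<subseteq> ?P"
      using i by (auto simp: in_prime_factors_iff intro: order_trans[OF dvd_imp_le])
    have "i = (\<Prod>p\<in>prime_factors i. p ^ multiplicity p i)"
      using i by (intro prime_factorization_nat) auto
    also have "\<dots> dvd (\<Prod>p\<in>prime_factors i. p ^ e p)"
    proof (intro prod_dvd_prod le_imp_power_dvd)
      fix p assume p: "p \<in> prime_factors i"
      have "p ^ multiplicity p i \<le> i" using i by (intro dvd_imp_le multiplicity_dvd) auto
      also have "i < p ^ (e p + 1)" using i e[of p] p sub by (auto intro: le_less_trans)
      finally have "multiplicity p i < e p + 1"
        using p prime_gt_1_nat by (subst (asm) power_strict_increasing_iff) auto
      thus "multiplicity p i \<le> e p" by simp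
    qed
    also have "\<dots> dvd D" unfolding D_def by (intro prod_dvd_prod_subset sub fin)
    finally show "i dvd D" .
  qed
qed

text \<open>
  Chebyshev's argument: \<open>m (2m choose m)\<close> is at least \<open>4\<^sup>m / 2\<close>, and it divides the least common
  multiple of \<open>1, \<dots>, 2m\<close>, which few primes would keep small.
\<close>
lemma four_power_le_power_card_primes:
  fixes m :: nat
  assumes "m > 0"
  shows "4 ^ m \<le> 2 * (2 * m) ^ card {p. prime p \<and> p \<le> 2 * m}"
proof -
  obtain D where D: "D > 0" "\<And>i. 1 \<le> i \<Longrightarrow> i \<le> 2 * m \<Longrightarrow> i dvd D"
    "D \<le> (2 * m) ^ card {p. prime p \<and> p \<le> 2 * m}"
    using common_multiple_le_power_card_primes[of "2 * m"] by blast
  have "m * ((2 * m) choose m) dvd D"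
    using assms D(2) by (intro times_binomial_dvd_common_multiple[of "2 * m"]) auto
  hence le: "m * ((2 * m) choose m) \<le> D" using D(1) by (rule dvd_imp_le)
  have "4 ^ m \<le> real (2 * (m * ((2 * m) choose m)))"
    using central_binomial_lower_bound[OF assms] assms by (simp add: field_simps)
  also have "\<dots> \<le> real (2 * D)" using le by (intro of_nat_mono) simp
  also have "\<dots> \<le> real (2 * (2 * m) ^ card {p. prime p \<and> p \<le> 2 * m})"
    using D(3) by (intro of_nat_mono) simp
  finally have "real (4 ^ m) \<le> real (2 * (2 * m) ^ card {p. prime p \<and> p \<le> 2 * m})" by simp
  thus ?thesis by (simp only: of_nat_le_iff)
qed

text \<open>
  Logarithms of \<open>four_power_le_power_card_primes\<close> for the largest even number \<open>2m \<le> y\<close>.  Of the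
  \<open>3\<close>, rounding \<open>y\<close> down to \<open>2m\<close> costs \<open>2\<close> and the factor \<open>2\<close> in front of the power costs \<open>1\<close>.
\<close>
lemma card_primes_lower_bound:
  fixes y :: real
  assumes "y \<ge> 2"
  shows "(y - 3) * ln 2 \<le> real (card {p :: nat. prime p \<and> real p \<le> y}) * ln y"
proof -
  define m where "m = nat \<lfloor>y / 2\<rfloor>"
  have m: "m > 0" "real (2 * m) \<le> y" "y - 2 \<le> real (2 * m)"
    using assms by (auto simp: m_def le_nat_iff) linarith+
  let ?P = "{p. prime p \<and> p \<le> 2 * m}" and ?Q = "{p :: nat. prime p \<and> real p \<le> y}"
  have "finite ?Q" by (rule finite_subset[of _ "{..nat \<lfloor>y\<rfloor>}"]) (auto simp: le_nat_floor)
  hence card: "card ?P \<le> card ?Q" using m by (intro card_mono) auto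
  have "real (4 ^ m) \<le> real (2 * (2 * m) ^ card ?P)"
    using four_power_le_power_card_primes[OF m(1)] by (rule of_nat_mono)
  hence "ln (4 ^ m) \<le> ln (2 * real (2 * m) ^ card ?P)"
    using m by (subst ln_le_cancel_iff) auto
  hence "real m * ln 4 \<le> ln 2 + real (card ?P) * ln (real (2 * m))"
    using m by (simp add: ln_mult ln_realpow del: of_nat_mult)
  moreover have "ln 4 = 2 * ln (2 :: real)"
    using ln_realpow[of 2 2] by simp
  ultimately have "(real (2 * m) - 1) * ln 2 \<le> real (card ?P) * ln (real (2 * m))"
    by (simp add: algebra_simps)
  moreover have "(y - 3) * ln 2 \<le> (real (2 * m) - 1) * ln 2"
    using m by (intro mult_right_mono) auto
  moreover have "real (card ?P) * ln (real (2 * m)) \<le> real (card ?Q) * ln y"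
    using m card by (intro mult_mono) auto
  ultimately show ?thesis by linarith
qed

text \<open>
  The primes are chosen arbitrarily among those up to \<open>y = (ln N)\<^sup>c\<close>.  As \<open>c > 1\<close>, the bound
  \<open>card_primes_lower_bound\<close>, of order \<open>y / ln y\<close>, eventually exceeds the required number
  \<open>ln N / (2 ln y)\<close>.
\<close>
lemma eventually_many_small_primes:
  fixes c :: real
  assumes "c > 1"
  shows "eventually (\<lambda>N::nat. \<exists>P. finite P \<and> (\<forall>p\<in>P. prime p) \<and> real (\<Prod>P) \<le> sqrt (real N) \<and>
           ln N / (2 * c * ln (ln N)) \<le> real (card P) + 1) sequentially"
proof -
  have "eventually (\<lambda>L::real. L > 0 \<and> L powr c \<ge> 2 \<and> (L powr c - 3) * ln 2 \<ge> L / 2) at_top"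
    using assms by (intro eventually_conj; real_asymp)
  moreover have "filterlim (\<lambda>N::nat. ln (real N)) at_top sequentially" by real_asymp
  ultimately have "eventually (\<lambda>N::nat. ln N > 0 \<and> ln N powr c \<ge> 2 \<and>
      (ln N powr c - 3) * ln 2 \<ge> ln N / 2) sequentially"
    by (rule eventually_compose_filterlim)
  with eventually_gt_at_top[of 0] show ?thesis
  proof eventually_elim
    case (elim N)
    define L y where "L = ln (real N)" and "y = L powr c"
    have L: "L > 0" "y \<ge> 2" "(y - 3) * ln 2 \<ge> L / 2" "N > 0" using elim by (auto simp: L_def y_def)
    have lny: "ln y = c * ln L" using L(1) by (simp add: y_def)
    have lny0: "ln y > 0" using L by simp
    let ?Q = "{p :: nat. prime p \<and> real p \<le> y}"
    define K where "K = nat \<lfloor>L / (2 * ln y)\<rfloor>"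
    have K: "real K \<le> L / (2 * ln y)" "L / (2 * ln y) \<le> real K + 1"
      using L(1) lny0 by (auto simp: K_def)
    have "L / 2 \<le> real (card ?Q) * ln y" using card_primes_lower_bound[of y] L by linarith
    hence "L / (2 * ln y) \<le> real (card ?Q)" using lny0 by (simp add: field_simps)
    hence "K \<le> card ?Q" using K by linarith
    then obtain P where P: "P \<subseteq> ?Q" "card P = K" "finite P" by (rule obtain_subset_with_card_n)
    have "real (\<Prod>P) = (\<Prod>p\<in>P. real p)" by simp
    also have "\<dots> \<le> (\<Prod>p\<in>P. y)" using P by (intro prod_mono) auto
    also have "\<dots> = exp (real K * ln y)" using P L by (simp add: exp_of_nat_mult)
    also have "\<dots> \<le> exp (L / 2)" using K(1) lny0 by (simp add: field_simps)
    also have "\<dots> = sqrt (real N)"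
    proof -
      have "L / 2 = ln (sqrt (real N))" using L by (simp add: L_def ln_sqrt)
      thus ?thesis using L by simp
    qed
    finally show ?case
      using P K(2) lny by (intro exI[of _ P]) (auto simp: L_def mult_ac)
  qed
qed

section \<open>The bound on Sidon sets\<close>

text \<open>
  Only finitely many \<open>n\<close> violate an eventually true \<open>Q\<close>, so a constant can absorb them.
  The set \<open>A\<close> in the final theorem is quantified for each \<open>N\<close>, hence the form with \<open>\<not> Q n\<close>
  instead of an eventual inequality between two fixed sequences.
\<close>
lemma constant_absorbing_exceptions:
  fixes f g :: "nat \<Rightarrow> real"
  assumes "eventually Q sequentially" "\<And>n. g n > 0"
  obtains C where "C \<ge> B" "\<And>n. \<not> Q n \<Longrightarrow> f n \<le> C * g n"
proof -
  obtain n0 where n0: "\<And>n. n \<ge> n0 \<Longrightarrow> Q n" using assms by (auto simp: eventually_sequentially)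
  define C where "C = Max (insert B ((\<lambda>n. f n / g n) ` {..<n0}))"
  show ?thesis
  proof (rule that)
    show "C \<ge> B" by (simp add: C_def)
    fix n assume "\<not> Q n"
    hence "n < n0" using n0 by (meson not_less)
    hence "f n / g n \<le> C" unfolding C_def by (intro Max_ge) auto
    thus "f n \<le> C * g n" using assms(2)[of n] by (simp add: field_simps)
  qed
qed

theorem theorem1p1:
  fixes \<alpha> \<delta> :: real
  assumes "0 < \<alpha>" and "\<alpha> < 1"
    and "0 < \<delta>" and "\<delta> < 1 / 4"
  shows "\<exists>C::real. C > 0 \<and>
    (\<forall>(N::nat) (A::int set).
       N \<ge> 3 \<longrightarrow> A \<subseteq> {1..int N} \<longrightarrow> sidon A \<longrightarrow>
       (\<forall>p::nat. prime p \<longrightarrow> real (card (residues_mod A p)) \<le> \<alpha> * real p) \<longrightarrow>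
       real (card A) \<le> C * (sqrt (real N) *
         exp (- ((1 / 4 - \<delta>) * ln (1 / \<alpha>) * (ln (real N) / ln (ln (real N)))))))"
proof -
  define c where "c = 1 / (1 - 4 * \<delta>)"
  have c: "c > 1" using assms by (simp add: c_def)
  define E where "E N = exp (- ((1 / 4 - \<delta>) * ln (1 / \<alpha>) * (ln (real N) / ln (ln (real N)))))" for N :: nat
  define Q where "Q N \<longleftrightarrow> (\<exists>P. finite P \<and> (\<forall>p\<in>P. prime p) \<and> real (\<Prod>P) \<le> sqrt (real N) \<and>
           ln N / (2 * c * ln (ln N)) \<le> real (card P) + 1)" for N :: nat
  \<comment> \<open>The absorbing constant needs a positive \<open>g\<close> everywhere; the product vanishes at \<open>N = 0\<close>.\<close>
  define g where "g N = (if N = 0 then 1 else sqrt (real N) * E N)" for N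
  have "eventually Q sequentially" unfolding Q_def by (rule eventually_many_small_primes[OF c])
  moreover have "g N > 0" for N by (simp add: g_def E_def)
  ultimately obtain C where C: "C \<ge> 2 / sqrt \<alpha>" "\<And>N. \<not> Q N \<Longrightarrow> real N \<le> C * g N"
    by (rule constant_absorbing_exceptions[where f = real and g = g and B = "2 / sqrt \<alpha>"]) (rule that)
  have "C > 0" using C(1) assms by (smt (verit) divide_pos_pos real_sqrt_gt_zero)
  have "real (card A) \<le> C * (sqrt (real N) * E N)"
    if N: "N \<ge> 3" and A: "A \<subseteq> {1..int N}" and sid: "sidon A"
      and res: "\<And>p. prime p \<Longrightarrow> real (card (residues_mod A p)) \<le> \<alpha> * real p" for N :: nat and A
  proof (cases "Q N")
    case False
    have "card A \<le> card {1..int N}" using A by (intro card_mono) auto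
    thus ?thesis using C(2)[OF False] N by (simp add: g_def)
  next
    case True
    then obtain P where P: "finite P" "\<forall>p\<in>P. prime p" "real (\<Prod>P) \<le> sqrt (real N)"
      "ln N / (2 * c * ln (ln N)) \<le> real (card P) + 1" unfolding Q_def by blast
    define u where "u = (1 / 4 - \<delta>) * (ln (real N) / ln (ln (real N)))"
    have u: "u \<le> (real (card P) + 1) / 2"
    proof -
      have "u = (ln N / (2 * c * ln (ln N))) / 2" using assms by (simp add: u_def c_def field_simps)
      thus ?thesis using P(4) by simp
    qed
    \<comment> \<open>As \<open>card P\<close> may fall short by one, a factor \<open>sqrt \<alpha>\<close> is inserted here; it becomes the
      constant \<open>2 / sqrt \<alpha>\<close>.\<close>
    have "sqrt (\<alpha> ^ card P) * sqrt \<alpha> = sqrt (\<alpha> ^ (card P + 1))"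
      by (simp add: real_sqrt_mult mult.commute)
    also have "\<dots> = \<alpha> powr ((real (card P) + 1) / 2)"
      using assms by (simp add: powr_half_sqrt[symmetric] powr_powr powr_realpow[symmetric] add.commute del: power_Suc)
    also have "\<dots> \<le> \<alpha> powr u" using assms u by (intro powr_mono') auto
    also have "\<dots> = E N" using assms by (simp add: E_def u_def powr_def ln_div mult_ac)
    finally have "sqrt (\<alpha> ^ card P) \<le> E N / sqrt \<alpha>" using assms by (simp add: field_simps)
    hence "2 * sqrt N * sqrt (\<alpha> ^ card P) \<le> 2 * sqrt N * (E N / sqrt \<alpha>)"
      by (intro mult_left_mono) auto
    moreover have "real (card A) \<le> 2 * sqrt N * sqrt (\<alpha> ^ card P)"
      using assms P res by (intro sidon_card_le_of_few_residues[OF sid A]) auto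
    ultimately have "real (card A) \<le> (2 / sqrt \<alpha>) * (sqrt (real N) * E N)" by simp
    also have "\<dots> \<le> C * (sqrt (real N) * E N)"
      using C(1) by (intro mult_right_mono) (auto simp: E_def)
    finally show ?thesis .
  qed
  thus ?thesis using \<open>C > 0\<close> unfolding E_def by blast
qed

end
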